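(* Let $N\ge0$ be an integer and $\epsilon$ a nonzero real number. The normalized state $$|\tilde N\rangle=\frac{1}{\sqrt{\mathcal N}}\,\frac{\sqrt{N!}}{N+1}\,\frac{e^{\epsilon^2/2}}{\epsilon^N}\sum_{k=0}^N e^{-2\pi i kN/(N+1)}\,\big|\epsilon e^{2\pi i k/(N+1)}\big\rangle,\qquad \mathcal N=N!\sum_{k=0}^\infty\frac{\epsilon^{2k(N+1)}}{(k(N+1)+N)!},$$ a superposition of $N+1$ coherent states, approximates the Fock state $|N\rangle$ with fidelity $$|\langle N|\tilde N\rangle|^2=\frac1{\mathcal N}=1-O\!\left(\frac{N!}{(2N+1)!}\epsilon^{2(N+1)}\right)\quad(\epsilon\to0).$$
   Context: Single-mode Fock basis $\{|n\rangle\}_{n\ge0}$. For $\alpha\in\mathbb C$, the coherent state is $|\alpha\rangle=e^{-|\alpha|^2/2}\sum_{n=0}^\infty\frac{\alpha^n}{\sqrt{n!}}|n\rangle$; Greek letters (and expressions such as $\epsilon e^{2\pi i k/(N+1)}$) inside kets denote coherent states, while $|N\rangle$ is the Fock state with $N$ photons. *)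

theory Defs
  imports "HOL-Analysis.Analysis" "HOL-Library.Landau_Symbols"
begin

text \<open>States of a single bosonic mode are represented by their Fock-basis amplitudes
  (nat \<Rightarrow> complex): the amplitude at n is the coefficient of the Fock state |n>.\<close>

definition coherent :: "complex \<Rightarrow> nat \<Rightarrow> complex" where
  "coherent \<alpha> n = complex_of_real (exp (- (cmod \<alpha>)\<^sup>2 / 2)) * \<alpha> ^ n
                   / complex_of_real (sqrt (fact n))"

definition normN :: "nat \<Rightarrow> real \<Rightarrow> real" where
  "normN N \<epsilon> = fact N * (\<Sum>k. \<epsilon> ^ (2 * k * (N + 1)) / fact (k * (N + 1) + N))"

definition Ntilde :: "nat \<Rightarrow> real \<Rightarrow> nat \<Rightarrow> complex" where
  "Ntilde N \<epsilon> n =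
     complex_of_real (1 / sqrt (normN N \<epsilon>) * sqrt (fact N) / real (N + 1)
                      * exp (\<epsilon>\<^sup>2 / 2) / \<epsilon> ^ N)
     * (\<Sum>k\<le>N. cis (- 2 * pi * real k * real N / real (N + 1))
                 * coherent (complex_of_real \<epsilon> * cis (2 * pi * real k / real (N + 1))) n)"

end

theory Submission
  imports Defs
begin

text \<open>With \<omega> = exp(2 \<pi> i/(N+1)), the k-th coherent state of the superposition is |\<epsilon> \<omega>^k\<rangle>
  and carries the phase \<omega>^(-kN) = \<omega>^k, so its n-th Fock amplitude picks up the factor (\<omega>^(n+1))^k.
  Summing over k is a discrete Fourier sum over the (N+1)-th roots of unity: it kills every Fock
  component except n = k(N+1) + N, whose amplitudes are those of |\<epsilon>\<rangle>, rescaled. Normalising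
  the surviving weights gives normN, and the weight at n = N is the fidelity 1/normN. Since
  normN = 1 + N! \<Sum>(k\<ge>1) \<epsilon>^(2k(N+1))/(k(N+1)+N)! and the tail is at most N! e \<epsilon>^(2(N+1))
  for |\<epsilon>| \<le> 1, the fidelity defect 1 - 1/normN \<le> normN - 1 is O(\<epsilon>^(2(N+1))).\<close>

lemma Suc_dvd_Suc_iff: "Suc m dvd Suc n \<longleftrightarrow> (\<exists>k. n = k * Suc m + m)"
proof
  assume "Suc m dvd Suc n"
  then obtain j where "Suc n = Suc m * j" ..
  then have "n = (j - 1) * Suc m + m"
    by (cases j) auto
  then show "\<exists>k. n = k * Suc m + m" ..
next
  assume "\<exists>k. n = k * Suc m + m"
  then obtain k where "n = k * Suc m + m" ..
  then have "Suc n = Suc m * Suc k"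
    by simp
  then show "Suc m dvd Suc n" ..
qed

lemma sum_powers_root_of_unity:
  assumes "m > 0"
  shows "(\<Sum>k<m. cis (2 * pi * real j / real m) ^ k) = (if m dvd j then of_nat m else 0)"
proof -
  define z where "z = cis (2 * pi * real j / real m)"
  have "z ^ m = cis (2 * pi * real j)"
    unfolding z_def Complex.DeMoivre using assms by simp
  then have "z ^ m = 1"
    by simp
  moreover have "z = 1 \<longleftrightarrow> m dvd j"
    using complex_root_unity_eq_1[of m j] assms by (simp add: z_def cis_conv_exp mult_ac)
  ultimately show ?thesis
    by (simp add: z_def [symmetric] sum_gp_strict)
qed

lemma coherent_rotate: "coherent (\<alpha> * cis \<theta>) n = cis \<theta> ^ n * coherent \<alpha> n"
  by (simp add: coherent_def norm_mult power_mult_distrib)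

lemma coherent_of_real:
  "coherent (complex_of_real x) n = complex_of_real (exp (- x\<^sup>2 / 2) * x ^ n / sqrt (fact n))"
  by (simp add: coherent_def)

lemma Ntilde_eq_filtered_coherent:
  "Ntilde N \<epsilon> n =
     (if Suc N dvd Suc n
      then complex_of_real (sqrt (fact N) / sqrt (normN N \<epsilon>) * exp (\<epsilon>\<^sup>2 / 2) / \<epsilon> ^ N)
           * coherent (complex_of_real \<epsilon>) n
      else 0)"
proof -
  define \<omega> where "\<omega> = cis (2 * pi / real (Suc N))"
  have rotation: "cis (2 * pi * real k / real (N + 1)) = \<omega> ^ k" for k
    unfolding \<omega>_def Complex.DeMoivre by (simp add: field_simps)
  have phase: "cis (- 2 * pi * real k * real N / real (N + 1)) = \<omega> ^ k" for k
  proof -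
    have "cis (- 2 * pi * real k * real N / real (N + 1))
          = cis (2 * pi * real k / real (N + 1)) / cis (2 * pi * real k)"
      unfolding cis_divide by (rule arg_cong [of _ _ cis]) (simp add: field_simps)
    then show ?thesis
      by (simp only: rotation) simp
  qed
  have root: "\<omega> ^ Suc n = cis (2 * pi * real (Suc n) / real (Suc N))"
    unfolding \<omega>_def Complex.DeMoivre by (simp add: mult.commute)
  have summand: "cis (- 2 * pi * real k * real N / real (N + 1))
      * coherent (complex_of_real \<epsilon> * cis (2 * pi * real k / real (N + 1))) n
    = coherent (complex_of_real \<epsilon>) n * (\<omega> ^ Suc n) ^ k" for k
    unfolding coherent_rotate unfolding phase rotation
    by (simp add: ac_simps del: power_Suc flip: power_mult power_add)
  have "(\<Sum>k\<le>N. cis (- 2 * pi * real k * real N / real (N + 1))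
                 * coherent (complex_of_real \<epsilon> * cis (2 * pi * real k / real (N + 1))) n)
        = coherent (complex_of_real \<epsilon>) n * (\<Sum>k<Suc N. cis (2 * pi * real (Suc n) / real (Suc N)) ^ k)"
    by (simp only: summand root sum_distrib_left lessThan_Suc_atMost)
  also have "\<dots> = (if Suc N dvd Suc n then of_nat (Suc N) * coherent (complex_of_real \<epsilon>) n else 0)"
    unfolding sum_powers_root_of_unity [OF zero_less_Suc] by simp
  finally show ?thesis
    by (simp add: Ntilde_def del: of_nat_Suc)
qed

lemma Ntilde_eq:
  assumes "\<epsilon> \<noteq> 0"
  shows "Ntilde N \<epsilon> n =
     (if Suc N dvd Suc n
      then complex_of_real (sqrt (fact N / normN N \<epsilon>) * \<epsilon> ^ (n - N) / sqrt (fact n))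
      else 0)"
proof (cases "Suc N dvd Suc n")
  case True
  then have "N \<le> n"
    using dvd_imp_le [OF True zero_less_Suc] by simp
  then have "\<epsilon> ^ n / \<epsilon> ^ N = \<epsilon> ^ (n - N)"
    using assms by (simp add: power_diff)
  moreover have "exp (\<epsilon>\<^sup>2 / 2) * exp (- \<epsilon>\<^sup>2 / 2) = 1"
    by (simp flip: exp_add)
  moreover have "sqrt (fact N) / sqrt (normN N \<epsilon>) * exp (\<epsilon>\<^sup>2 / 2) / \<epsilon> ^ N
        * (exp (- \<epsilon>\<^sup>2 / 2) * \<epsilon> ^ n / sqrt (fact n))
      = sqrt (fact N) / sqrt (normN N \<epsilon>) * (exp (\<epsilon>\<^sup>2 / 2) * exp (- \<epsilon>\<^sup>2 / 2))
        * (\<epsilon> ^ n / \<epsilon> ^ N) / sqrt (fact n)"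
    by (simp only: divide_inverse mult_ac)
  ultimately have "sqrt (fact N) / sqrt (normN N \<epsilon>) * exp (\<epsilon>\<^sup>2 / 2) / \<epsilon> ^ N
        * (exp (- \<epsilon>\<^sup>2 / 2) * \<epsilon> ^ n / sqrt (fact n))
      = sqrt (fact N / normN N \<epsilon>) * \<epsilon> ^ (n - N) / sqrt (fact n)"
    by (simp only: real_sqrt_divide mult_1_right)
  with True show ?thesis
    by (simp only: Ntilde_eq_filtered_coherent coherent_of_real of_real_mult [symmetric] if_True)
next
  case False
  then show ?thesis
    by (simp add: Ntilde_eq_filtered_coherent)
qed

definition normN_term :: "nat \<Rightarrow> real \<Rightarrow> nat \<Rightarrow> real" where
  "normN_term N \<epsilon> k = \<epsilon> ^ (2 * k * (N + 1)) / fact (k * (N + 1) + N)"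

lemma normN_eq_suminf: "normN N \<epsilon> = fact N * (\<Sum>k. normN_term N \<epsilon> k)"
  by (simp add: normN_def normN_term_def)

lemma normN_term_eq: "normN_term N \<epsilon> k = (\<epsilon> ^ (2 * (N + 1))) ^ k / fact (k * (N + 1) + N)"
  unfolding normN_term_def power_mult [symmetric] by (simp only: ac_simps)

lemma normN_term_nonneg: "0 \<le> normN_term N \<epsilon> k"
  unfolding normN_term_eq by (intro divide_nonneg_pos zero_le_power zero_le_even_power') simp

lemma normN_term_0: "normN_term N \<epsilon> 0 = 1 / fact N"
  by (simp add: normN_term_def)

lemma normN_term_le_exp_term: "normN_term N \<epsilon> k \<le> (\<epsilon> ^ (2 * (N + 1))) ^ k / fact k"
  unfolding normN_term_eq
  by (intro divide_left_mono fact_mono zero_le_power zero_le_even_power') simp_all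

lemma summable_normN_term: "summable (normN_term N \<epsilon>)"
proof (rule summable_comparison_test')
  show "summable (\<lambda>k. (\<epsilon> ^ (2 * (N + 1))) ^ k / fact k)"
    using summable_exp [of "\<epsilon> ^ (2 * (N + 1))"] by (simp only: divide_inverse mult.commute)
  show "norm (normN_term N \<epsilon> k) \<le> (\<epsilon> ^ (2 * (N + 1))) ^ k / fact k" for k
    using normN_term_le_exp_term normN_term_nonneg by (simp only: real_norm_def abs_of_nonneg)
qed

lemma normN_eq_1_plus_tail: "normN N \<epsilon> = 1 + fact N * (\<Sum>k. normN_term N \<epsilon> (Suc k))"
proof -
  have "(\<Sum>k. normN_term N \<epsilon> k) = 1 / fact N + (\<Sum>k. normN_term N \<epsilon> (Suc k))"
    using suminf_split_head [OF summable_normN_term] normN_term_0 by simp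
  then show ?thesis
    by (simp add: normN_eq_suminf distrib_left)
qed

lemma normN_ge_1: "1 \<le> normN N \<epsilon>"
proof -
  have "0 \<le> (\<Sum>k. normN_term N \<epsilon> (Suc k))"
    using summable_normN_term by (intro suminf_nonneg normN_term_nonneg) (simp only: summable_Suc_iff)
  then show ?thesis
    unfolding normN_eq_1_plus_tail by simp
qed

lemma cmod_Ntilde_squared:
  assumes "\<epsilon> \<noteq> 0"
  shows "(cmod (Ntilde N \<epsilon> (k * Suc N + N)))\<^sup>2 = fact N / normN N \<epsilon> * normN_term N \<epsilon> k"
proof -
  have "Suc N dvd Suc (k * Suc N + N)"
    by (auto simp: Suc_dvd_Suc_iff)
  then have "Ntilde N \<epsilon> (k * Suc N + N)
      = complex_of_real (sqrt (fact N / normN N \<epsilon>) * \<epsilon> ^ (k * Suc N) / sqrt (fact (k * Suc N + N)))"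
    by (simp only: Ntilde_eq [OF assms] if_True add_diff_cancel_right')
  moreover have "(\<epsilon> ^ (k * Suc N))\<^sup>2 = \<epsilon> ^ (2 * k * (N + 1))"
    by (simp only: power_mult [symmetric] ac_simps Suc_eq_plus1)
  ultimately show ?thesis
    using normN_ge_1 [of N \<epsilon>]
    by (simp add: normN_term_def power_divide power_mult_distrib del: of_real_mult of_real_divide)
qed

lemma Ntilde_norm_sums:
  assumes "\<epsilon> \<noteq> 0"
  shows "(\<lambda>n. (cmod (Ntilde N \<epsilon> n))\<^sup>2) sums 1"
proof -
  let ?g = "\<lambda>k. k * Suc N + N"
  have mono: "strict_mono ?g"
    by (rule strict_monoI) (auto intro: add_less_le_mono)
  have off_support: "(cmod (Ntilde N \<epsilon> n))\<^sup>2 = 0" if "n \<notin> range ?g" for n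
    using that by (auto simp: Ntilde_eq [OF assms] Suc_dvd_Suc_iff)
  have "(\<lambda>k. fact N / normN N \<epsilon> * normN_term N \<epsilon> k)
      sums (fact N / normN N \<epsilon> * (\<Sum>k. normN_term N \<epsilon> k))"
    by (intro sums_mult summable_sums summable_normN_term)
  also have "fact N / normN N \<epsilon> * (\<Sum>k. normN_term N \<epsilon> k) = 1"
    using normN_ge_1 [of N \<epsilon>] by (auto simp: normN_eq_suminf)
  finally have "(\<lambda>k. (cmod (Ntilde N \<epsilon> (?g k)))\<^sup>2) sums 1"
    unfolding cmod_Ntilde_squared [OF assms] .
  then show ?thesis
    using sums_mono_reindex [of ?g "\<lambda>n. (cmod (Ntilde N \<epsilon> n))\<^sup>2", OF mono off_support]
    by blast
qed

lemma normN_minus_1_le: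
  assumes "\<bar>\<epsilon>\<bar> \<le> 1"
  shows "normN N \<epsilon> - 1 \<le> fact N * exp 1 * \<epsilon> ^ (2 * (N + 1))"
proof -
  define y where "y = \<epsilon> ^ (2 * (N + 1))"
  have "0 \<le> y"
    unfolding y_def by (rule zero_le_even_power')
  have "y = \<bar>\<epsilon>\<bar> ^ (2 * (N + 1))"
    unfolding y_def by (rule power_even_abs [symmetric]) simp
  then have "y \<le> 1"
    using assms by (simp only: power_le_one abs_ge_zero)
  have exp_series: "(\<lambda>k. inverse (fact k)) sums exp (1::real)"
    using exp_converges [of "1::real"] by (simp add: scaleR_conv_of_real)
  have term_le: "normN_term N \<epsilon> (Suc k) \<le> y * inverse (fact k)" for k
  proof -
    have "normN_term N \<epsilon> (Suc k) \<le> y ^ Suc k / fact (Suc k)"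
      using normN_term_le_exp_term unfolding y_def .
    also have "\<dots> \<le> y / fact k"
      using \<open>0 \<le> y\<close> \<open>y \<le> 1\<close>
      by (intro frac_le) (simp_all add: power_le_one mult_left_le fact_mono)
    finally show ?thesis
      by (simp add: divide_inverse)
  qed
  have "(\<Sum>k. normN_term N \<epsilon> (Suc k)) \<le> (\<Sum>k. y * inverse (fact k))"
    using term_le summable_normN_term exp_series
    by (intro suminf_le) (auto simp: summable_Suc_iff intro: summable_mult sums_summable)
  also have "\<dots> = y * exp 1"
    using exp_series by (simp add: suminf_mult sums_unique [symmetric] sums_summable)
  finally show ?thesis
    unfolding normN_eq_1_plus_tail y_def by (simp add: mult_left_mono mult_ac)
qed

lemma fidelity_defect_le:
  assumes "\<bar>\<epsilon>\<bar> \<le> 1"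
  shows "\<bar>1 - 1 / normN N \<epsilon>\<bar> \<le> fact N * exp 1 * \<epsilon> ^ (2 * (N + 1))"
proof -
  have "\<bar>1 - 1 / normN N \<epsilon>\<bar> = (normN N \<epsilon> - 1) / normN N \<epsilon>"
    using normN_ge_1 [of N \<epsilon>] by (simp add: field_simps)
  also have "\<dots> \<le> normN N \<epsilon> - 1"
    using normN_ge_1 [of N \<epsilon>] by (simp add: divide_le_eq mult_le_cancel_left1)
  also have "\<dots> \<le> fact N * exp 1 * \<epsilon> ^ (2 * (N + 1))"
    using assms by (rule normN_minus_1_le)
  finally show ?thesis .
qed

lemma fidelity_defect_bigo: "(\<lambda>\<epsilon>. 1 - 1 / normN N \<epsilon>) \<in> O[at 0](\<lambda>\<epsilon>. \<epsilon> ^ (2 * (N + 1)))"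
proof (rule bigoI)
  have "\<forall>\<^sub>F \<epsilon> in at (0::real). \<bar>\<epsilon>\<bar> \<le> 1"
    by (auto simp: eventually_at intro!: exI [of _ 1])
  then show "\<forall>\<^sub>F \<epsilon> in at 0.
      norm (1 - 1 / normN N \<epsilon>) \<le> fact N * exp 1 * norm (\<epsilon> ^ (2 * (N + 1)))"
    by eventually_elim
      (simp only: real_norm_def abs_of_nonneg [OF zero_le_even_power'] fidelity_defect_le)
qed

theorem corollary1:
  fixes N :: nat
  shows "(\<forall>\<epsilon>::real. \<epsilon> \<noteq> 0 \<longrightarrow>
            ((\<lambda>n. (cmod (Ntilde N \<epsilon> n))\<^sup>2) sums 1) \<and>
            (cmod (Ntilde N \<epsilon> N))\<^sup>2 = 1 / normN N \<epsilon>)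
         \<and> (\<lambda>\<epsilon>. 1 - 1 / normN N \<epsilon>)
             \<in> O[at 0](\<lambda>\<epsilon>. fact N / fact (2 * N + 1) * \<epsilon> ^ (2 * (N + 1)))"
proof (intro conjI allI impI)
  fix \<epsilon> :: real
  assume "\<epsilon> \<noteq> 0"
  then show "(\<lambda>n. (cmod (Ntilde N \<epsilon> n))\<^sup>2) sums 1"
    by (rule Ntilde_norm_sums)
  show "(cmod (Ntilde N \<epsilon> N))\<^sup>2 = 1 / normN N \<epsilon>"
    using cmod_Ntilde_squared [OF \<open>\<epsilon> \<noteq> 0\<close>, of N 0] by (simp add: normN_term_0)
next
  \<comment> \<open>the paper's constant N!/(2N+1)! only fixes the scale; it does not change the O-class\<close>
  show "(\<lambda>\<epsilon>. 1 - 1 / normN N \<epsilon>) \<in> O[at 0](\<lambda>\<epsilon>. fact N / fact (2 * N + 1) * \<epsilon> ^ (2 * (N + 1)))"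
    using fidelity_defect_bigo by simp
qed

end
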